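(* Let $(e_n)_{n\ge1}$ be an orthonormal basis of $\mathcal H$ and let $(k_n)_{n\ge1}$ be a sequence of positive integers with $k_{n+1}\ge qk_n$ for all $n$, for some $q>1$. Not all strictly positive compact diagonal operators (relative to $(e_n)$) can be represented as commutators of compact operators using the exponential Anderson model (EAM) with block sizes $(k_n)$: there is a strictly positive sequence $(d_n)$ converging to zero such that $\operatorname{diag}(d_n)\ne CZ-ZC$ for all compact operators $C,Z$ of the (EAM) form with block sizes $(k_n)$.
   Context: $\mathcal H$ is an infinite dimensional separable complex Hilbert space and $\operatorname{diag}(d_n)$ is the operator sending $e_n$ to $d_ne_n$. (EAM) form with block sizes $(k_n)$: relative to $(e_n)$, partitioned into consecutive blocks of sizes $k_1,k_2,\dots$, both $C$ and $Z$ are block tridiagonal (the $(i,j)$ block is zero if $|i-j|>1$) with all diagonal ($k_n\times k_n$) blocks equal to $0$. The $(n,n+1)$ and $(n+1,n)$ blocks of $C$ are $A_n$ (size $k_n\times k_{n+1}$) and $B_n$ (size $k_{n+1}\times k_n$); the $(n,n+1)$ and $(n+1,n)$ blocks of $Z$ are $X_n$ (size $k_n\times k_{n+1}$) and $Y_n$ (size $k_{n+1}\times k_n$). There are scalars $a_{k,n},b_{k,n},x_{k,n},y_{k,n}$ ($1\le k\le k_n$) such that the only possibly nonzero entries of these blocks are $A_n(k,k)=a_{k,n}$, $X_n(k,k+1)=x_{k,n}$, $B_n(k+1,k)=-b_{k,n}$, $Y_n(k,k)=y_{k,n}$, for $1\le k\le k_n$. *)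

theory Defs
  imports "HOL-Analysis.Analysis"
begin

text \<open>Complex Hilbert spaces. The real structure (real scalar multiplication, inner product, norm,
  metric) is the one underlying the complex structure, so that the library's notions of
  convergence, closure and compactness apply. The complex inner product is linear in its first
  argument.\<close>

class complex_hilbert = real_inner + complete_space +
  fixes scaleC :: "complex \<Rightarrow> 'a \<Rightarrow> 'a" (infixr "*\<^sub>C" 75)
    and cinner :: "'a \<Rightarrow> 'a \<Rightarrow> complex"
  assumes scaleC_add_right: "z *\<^sub>C (u + v) = z *\<^sub>C u + z *\<^sub>C v"
    and scaleC_add_left: "(z + c) *\<^sub>C u = z *\<^sub>C u + c *\<^sub>C u"
    and scaleC_scaleC: "z *\<^sub>C c *\<^sub>C u = (z * c) *\<^sub>C u"
    and scaleC_of_real: "complex_of_real r *\<^sub>C u = r *\<^sub>R u"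
    and cinner_commute: "cinner u v = cnj (cinner v u)"
    and cinner_add_left: "cinner (u + v) w = cinner u w + cinner v w"
    and cinner_scaleC_left: "cinner (z *\<^sub>C u) v = z * cinner u v"
    and Re_cinner: "Re (cinner u v) = inner u v"

lemma scaleC_one: "1 *\<^sub>C u = (u :: 'a::complex_hilbert)"
  using scaleC_of_real[of 1 u] by simp

global_interpretation complex_vector: vector_space "scaleC :: complex \<Rightarrow> 'a \<Rightarrow> 'a::complex_hilbert"
  defines cspan = complex_vector.span
  by unfold_locales (simp_all add: scaleC_add_right scaleC_add_left scaleC_scaleC scaleC_one)

definition orthonormal_basis :: "(nat \<Rightarrow> 'a::complex_hilbert) \<Rightarrow> bool" where
  "orthonormal_basis e \<longleftrightarrow>
     (\<forall>m n. cinner (e m) (e n) = (if m = n then 1 else 0)) \<and> closure (cspan (range e)) = UNIV"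

definition compact_operator :: "('a::complex_hilbert \<Rightarrow> 'a) \<Rightarrow> bool" where
  "compact_operator T \<longleftrightarrow>
     Vector_Spaces.linear scaleC scaleC T \<and> (\<forall>S. bounded S \<longrightarrow> compact (closure (T ` S)))"

definition diag :: "(nat \<Rightarrow> 'a::complex_hilbert) \<Rightarrow> (nat \<Rightarrow> complex) \<Rightarrow> 'a \<Rightarrow> 'a" where
  "diag e d u = (\<Sum>n. (d n * cinner u (e n)) *\<^sub>C e n)"

lemma diag_basis:
  assumes "orthonormal_basis e"
  shows "diag e d (e n) = d n *\<^sub>C e n"
proof -
  have "(\<lambda>m. (d m * cinner (e n) (e m)) *\<^sub>C e m) = (\<lambda>m. if m = n then d m *\<^sub>C e m else 0)"
    using assms by (auto simp: orthonormal_basis_def)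
  then show ?thesis
    using sums_unique[OF sums_single[of n "\<lambda>m. d m *\<^sub>C e m"]] by (simp add: diag_def)
qed

text \<open>All indices start at \<open>0\<close>: block number \<open>n\<close> (of size \<open>k n\<close>) consists of the basis vectors
  \<open>e (k 0 + \<dots> + k (n - 1) + i)\<close> with \<open>i < k n\<close>. The \<open>(i, j)\<close> entry of the \<open>(m, n)\<close> block of the
  matrix of \<open>T\<close> is meaningful for \<open>i < k m\<close> and \<open>j < k n\<close> only.\<close>

definition block_vec :: "(nat \<Rightarrow> 'a) \<Rightarrow> (nat \<Rightarrow> nat) \<Rightarrow> nat \<Rightarrow> nat \<Rightarrow> 'a" where
  "block_vec e k n i = e ((\<Sum>l<n. k l) + i)"

definition block_entry ::
  "(nat \<Rightarrow> 'a::complex_hilbert) \<Rightarrow> (nat \<Rightarrow> nat) \<Rightarrow> ('a \<Rightarrow> 'a) \<Rightarrow> nat \<Rightarrow> nat \<Rightarrow> nat \<Rightarrow> nat \<Rightarrow> complex" where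
  "block_entry e k T m n i j = cinner (T (block_vec e k n j)) (block_vec e k m i)"

text \<open>The blocks of \<open>C\<close> are \<open>A\<^sub>n\<close> (above the diagonal) with \<open>A\<^sub>n(i,i) = a i n\<close> and \<open>B\<^sub>n\<close> (below) with
  \<open>B\<^sub>n(i+1,i) = - b i n\<close>; those of \<open>Z\<close> are \<open>X\<^sub>n\<close> (above) with \<open>X\<^sub>n(i,i+1) = x i n\<close> and \<open>Y\<^sub>n\<close> (below)
  with \<open>Y\<^sub>n(i,i) = y i n\<close>.\<close>

definition EAM_form ::
  "(nat \<Rightarrow> 'a::complex_hilbert) \<Rightarrow> (nat \<Rightarrow> nat) \<Rightarrow> ('a \<Rightarrow> 'a) \<Rightarrow> ('a \<Rightarrow> 'a) \<Rightarrow> bool" where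
  "EAM_form e k C Z \<longleftrightarrow>
     (\<exists>a b x y :: nat \<Rightarrow> nat \<Rightarrow> complex. \<forall>m n i j. i < k m \<longrightarrow> j < k n \<longrightarrow>
        block_entry e k C m n i j =
          (if n = m + 1 \<and> j = i then a i m
           else if m = n + 1 \<and> i = j + 1 then - b j n
           else 0) \<and>
        block_entry e k Z m n i j =
          (if n = m + 1 \<and> j = i + 1 then x i m
           else if m = n + 1 \<and> i = j then y j n
           else 0))"

end

theory Submission imports Defs begin

text \<open>Write \<open>v\<^bsub>n,i\<^esub>\<close> for the \<open>i\<close>-th vector of block \<open>n\<close>. Comparing the diagonal entries of
  \<open>diag d = C Z - Z C\<close> at \<open>v\<^bsub>n+1,i\<^esub>\<close> gives, with \<open>s\<^bsub>n,i\<^esub> = a\<^bsub>i,n\<^esub> y\<^bsub>i,n\<^esub>\<close> and \<open>t\<^bsub>n,i\<^esub> = b\<^bsub>i,n\<^esub> x\<^bsub>i,n\<^esub>\<close>,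
  \<open>d\<^bsub>n+1,i\<^esub> = (s\<^bsub>n+1,i\<^esub> + t\<^bsub>n+1,i\<^esub>) - (s\<^bsub>n,i\<^esub> + t\<^bsub>n,i-1\<^esub>)\<close>
  (\<open>EAM_commutator_diagonal_entry\<close>). This is the balance of a flow: each node \<open>(n, i)\<close> receives the
  mass \<open>d\<^bsub>n,i\<^esub>\<close> and sends all it has to the next block, \<open>s\<^bsub>n,i\<^esub>\<close> to the same column \<open>i\<close> and \<open>t\<^bsub>n,i\<^esub>\<close>
  to the column \<open>i + 1\<close>. Compactness of \<open>C\<close> and \<open>Z\<close> makes the amounts \<open>s\<close> and \<open>t\<close> uniformly small
  in late blocks (\<open>compact_operator_block_entries_small\<close>).

  Now consider only the first \<open>J = k\<^sub>M\<close> columns, from block \<open>M\<close> on. At each step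
  mass leaves them through a single edge only, from column \<open>J - 1\<close> to column \<open>J\<close>, and the mass inside
  them is at most \<open>J\<close> times a small number in modulus. If \<open>d = 1 / (n + 1)\<close> throughout block \<open>n\<close>, then between block \<open>M\<close> and block \<open>2 M\<close>
  they receive at least \<open>J M / (3 M) = J / 3\<close>, whereas at most a small multiple of \<open>M\<close> leaves. As
  the block sizes grow, \<open>M \<le> k\<^sub>M = J\<close>, and what is received cannot be
  accommodated (\<open>slow_flow_contradiction\<close>).\<close>

section \<open>The complex inner product\<close>

lemma cinner_zero_left: "cinner 0 v = (0 :: complex)"
  using cinner_add_left[of 0 0 v] by simp

lemma cinner_minus_left: "cinner (- u) v = - cinner u v"
  using cinner_add_left[of u "- u" v] by (simp add: cinner_zero_left eq_neg_iff_add_eq_0 add.commute)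

lemma cinner_diff_left: "cinner (u - v) w = cinner u w - cinner v w"
  using cinner_add_left[of u "- v" w] by (simp add: cinner_minus_left)

lemma cinner_scaleC_right: "cinner u (z *\<^sub>C v) = cnj z * cinner u v"
  by (metis cinner_commute cinner_scaleC_left complex_cnj_mult)

lemma norm_scaleC: "norm (z *\<^sub>C u) = cmod z * norm (u :: 'a::complex_hilbert)"
proof -
  have "inner (z *\<^sub>C u) (z *\<^sub>C u) = Re (z * cnj z * cinner u u)"
    by (simp flip: Re_cinner add: cinner_scaleC_left cinner_scaleC_right mult_ac)
  also have "\<dots> = (cmod z)\<^sup>2 * inner u u"
    by (simp flip: complex_norm_square Re_cinner add: power2_eq_square)
  finally show ?thesis
    by (simp add: norm_eq_sqrt_inner real_sqrt_mult)
qed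

text \<open>Multiplying \<open>u\<close> by a phase makes the complex inner product real and nonnegative, so that it
  agrees with the real inner product.\<close>

lemma cmod_cinner_le: "cmod (cinner u v) \<le> norm u * norm (v :: 'a::complex_hilbert)"
proof -
  \<comment> \<open>The value \<open>sgn 0 = 0\<close> is harmless, since only \<open>cmod c \<le> 1\<close> matters below.\<close>
  define c where "c = cnj (sgn (cinner u v))"
  have "c * cinner u v = of_real (cmod (cinner u v))"
    by (cases "cinner u v = 0")
       (simp_all add: c_def complex_sgn_def scaleR_conv_of_real
          power2_eq_square field_simps flip: complex_norm_square)
  then have "cmod (cinner u v) = inner (c *\<^sub>C u) v"
    by (simp flip: Re_cinner add: cinner_scaleC_left)
  also have "\<dots> \<le> norm (c *\<^sub>C u) * norm v"
    by (rule norm_cauchy_schwarz)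
  also have "\<dots> \<le> norm u * norm v"
    by (intro mult_right_mono) (auto simp: norm_scaleC c_def norm_sgn)
  finally show ?thesis .
qed

section \<open>Orthonormal bases and compact operators\<close>

lemma cinner_basis:
  assumes "orthonormal_basis e"
  shows "cinner (e m) (e n) = (if m = n then 1 else 0)"
  using assms by (auto simp: orthonormal_basis_def)

lemma norm_basis:
  assumes "orthonormal_basis e"
  shows "norm (e n) = 1"
  using cinner_basis[OF assms, of n n] Re_cinner[of "e n" "e n"] by (simp add: norm_eq_sqrt_inner)

lemma cspan_approximation:
  assumes "orthonormal_basis e" and "r > 0"
  obtains u where "u \<in> cspan (range e)" and "dist u w < r"
  using assms closure_approachable[of w "cspan (range e)"]
  unfolding orthonormal_basis_def by blast

lemma cspan_basis_eventually_orthogonal: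
  assumes onb: "orthonormal_basis e" and "u \<in> cspan (range e)"
  shows "\<forall>\<^sub>F p in sequentially. cinner u (e p) = 0"
  using assms(2)
proof (induction rule: complex_vector.span_induct_alt)
  case base
  then show ?case by (simp add: cinner_zero_left)
next
  case (step c w v)
  then obtain n where "w = e n" by blast
  show ?case
    using step.IH eventually_gt_at_top[of n]
    by eventually_elim
      (simp add: \<open>w = e n\<close> cinner_add_left cinner_scaleC_left cinner_basis[OF onb])
qed

lemma orthonormal_basis_eq_0I:
  assumes onb: "orthonormal_basis e" and orth: "\<And>p. cinner w (e p) = 0"
  shows "w = 0"
proof (rule ccontr)
  assume "w \<noteq> 0"
  then obtain u where u: "u \<in> cspan (range e)" and dist: "dist u w < norm w"
    using cspan_approximation[OF onb, of "norm w" w] by auto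
  have "cinner u w = 0"
    using u
  proof (induction rule: complex_vector.span_induct_alt)
    case (step c x y)
    then have "cinner x w = 0"
      using cinner_commute[of x w] orth by auto
    with step show ?case
      by (simp add: cinner_add_left cinner_scaleC_left)
  qed (simp add: cinner_zero_left)
  then have "(norm w)\<^sup>2 = inner (w - u) w"
    by (simp add: cinner_diff_left power2_norm_eq_inner flip: Re_cinner)
  also have "\<dots> \<le> norm (w - u) * norm w"
    by (rule norm_cauchy_schwarz)
  also have "\<dots> < norm w * norm w"
    using dist \<open>w \<noteq> 0\<close> by (intro mult_strict_right_mono) (auto simp: dist_norm norm_minus_commute)
  finally show False
    by (simp add: power2_eq_square)
qed

text \<open>The image of the unit ball is covered by finitely many small balls with centres in the span of
  the basis, and each centre is orthogonal to all but finitely many basis vectors. This makes the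
  entries of the matrix small in all but finitely many rows, uniformly over the columns.\<close>

lemma compact_operator_entries_small:
  assumes onb: "orthonormal_basis e" and T: "compact_operator T" and "r > 0"
  shows "\<forall>\<^sub>F p in sequentially. \<forall>n. cmod (cinner (T (e n)) (e p)) \<le> r"
proof -
  define K where "K = closure (T ` cball 0 1)"
  have "compact K"
    using T by (simp add: compact_operator_def K_def)
  moreover have "K \<subseteq> (\<Union>u\<in>cspan (range e). ball u r)"
  proof
    fix w
    obtain u where "u \<in> cspan (range e)" "dist u w < r"
      using cspan_approximation[OF onb \<open>r > 0\<close>] .
    then show "w \<in> (\<Union>u\<in>cspan (range e). ball u r)" by auto
  qed
  ultimately obtain F where F: "F \<subseteq> cspan (range e)" "finite F" "K \<subseteq> (\<Union>u\<in>F. ball u r)"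
    by (metis compactE_image open_ball)
  have "\<forall>\<^sub>F p in sequentially. \<forall>u\<in>F. cinner u (e p) = 0"
    using F cspan_basis_eventually_orthogonal[OF onb] by (auto intro!: eventually_ball_finite)
  then show ?thesis
  proof (rule eventually_mono, intro allI)
    fix p n
    assume p: "\<forall>u\<in>F. cinner u (e p) = 0"
    have "T (e n) \<in> K"
      unfolding K_def using norm_basis[OF onb] by (intro closure_subset[THEN subsetD] imageI) auto
    then obtain u where u: "u \<in> F" "dist u (T (e n)) < r"
      using F by auto
    have "cinner (T (e n)) (e p) = cinner (T (e n) - u) (e p)"
      using p u by (simp add: cinner_diff_left)
    then have "cmod (cinner (T (e n)) (e p)) \<le> norm (T (e n) - u)"
      using cmod_cinner_le[of "T (e n) - u" "e p"] norm_basis[OF onb] by simp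
    also have "\<dots> \<le> r"
      using u by (simp add: dist_norm norm_minus_commute)
    finally show "cmod (cinner (T (e n)) (e p)) \<le> r" .
  qed
qed

section \<open>Block decomposition of the index set\<close>

definition block_number :: "(nat \<Rightarrow> nat) \<Rightarrow> nat \<Rightarrow> nat" where
  "block_number k p = (LEAST n. p < (\<Sum>l<Suc n. k l))"

lemma le_block_start:
  fixes k :: "nat \<Rightarrow> nat"
  assumes "\<And>n. k n > 0"
  shows "n \<le> (\<Sum>l<n. k l)"
  using sum_mono[of "{..<n}" "\<lambda>_. 1" k] assms by (simp add: Suc_le_eq)

lemma block_number_eq:
  assumes "i < k n"
  shows "block_number k ((\<Sum>l<n. k l) + i) = n"
  unfolding block_number_def
proof (rule Least_equality)
  fix m assume m: "(\<Sum>l<n. k l) + i < (\<Sum>l<Suc m. k l)"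
  show "n \<le> m"
  proof (rule ccontr)
    assume "\<not> n \<le> m"
    then have "(\<Sum>l<Suc m. k l) \<le> (\<Sum>l<n. k l)"
      by (intro sum_mono2) auto
    with m show False by simp
  qed
qed (use assms in simp)

lemma block_number_cases:
  assumes "\<And>n. k n > 0"
  obtains i where "i < k (block_number k p)" and "p = (\<Sum>l<block_number k p. k l) + i"
proof -
  define n where "n = block_number k p"
  have ex: "p < (\<Sum>l<Suc p. k l)"
    using le_block_start[of k "Suc p"] assms by simp
  have less: "p < (\<Sum>l<Suc n. k l)"
    unfolding n_def block_number_def using ex by (rule LeastI)
  have "(\<Sum>l<n. k l) \<le> p"
  proof (cases n)
    case (Suc m)
    then show ?thesis
      using not_less_Least[of m "\<lambda>n. p < (\<Sum>l<Suc n. k l)"]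
      by (simp add: n_def block_number_def not_less)
  qed simp
  with less show ?thesis
    using that[of "p - (\<Sum>l<n. k l)"] by (simp add: n_def)
qed

lemma block_number_at_top:
  assumes "\<And>n. k n > 0"
  shows "filterlim (block_number k) at_top sequentially"
  unfolding filterlim_at_top
proof
  fix n
  show "\<forall>\<^sub>F p in sequentially. n \<le> block_number k p"
    using eventually_ge_at_top[of "\<Sum>l<n. k l"]
  proof eventually_elim
    case (elim p)
    obtain i where i: "i < k (block_number k p)" "p = (\<Sum>l<block_number k p. k l) + i"
      using block_number_cases[OF assms] .
    show ?case
    proof (rule ccontr)
      assume "\<not> n \<le> block_number k p"
      then have "(\<Sum>l<Suc (block_number k p). k l) \<le> (\<Sum>l<n. k l)"
        by (intro sum_mono2) auto
      with i elim show False by simp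
    qed
  qed
qed

lemma cinner_block_vec:
  assumes onb: "orthonormal_basis e" and "i < k m" and "j < k n"
  shows "cinner (block_vec e k m i) (block_vec e k n j) = (if m = n \<and> i = j then 1 else 0)"
proof -
  have "m = n \<and> i = j" if "(\<Sum>l<m. k l) + i = (\<Sum>l<n. k l) + j"
    using block_number_eq[of i k m] block_number_eq[of j k n] assms that by simp
  then show ?thesis
    by (auto simp: block_vec_def cinner_basis[OF onb])
qed

lemma block_vec_eqI:
  assumes onb: "orthonormal_basis e" and k: "\<And>n. k n > 0"
    and eq: "\<And>n i. i < k n \<Longrightarrow> cinner u (block_vec e k n i) = cinner v (block_vec e k n i)"
  shows "u = v"
proof -
  have "cinner (u - v) (e p) = 0" for p
  proof -
    obtain i where "i < k (block_number k p)" "p = (\<Sum>l<block_number k p. k l) + i"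
      using block_number_cases[OF k] .
    with eq[of i "block_number k p"] show ?thesis
      by (simp add: block_vec_def cinner_diff_left)
  qed
  from orthonormal_basis_eq_0I[OF onb this] show ?thesis by simp
qed

lemma compact_operator_block_entries_small:
  assumes onb: "orthonormal_basis e" and k: "\<And>n. k n > 0" and T: "compact_operator T" and "r > 0"
  shows "\<forall>\<^sub>F m in sequentially. \<forall>m'\<ge>m. \<forall>n i j. cmod (block_entry e k T m' n i j) \<le> r"
proof -
  obtain Q where Q: "\<And>p n. p \<ge> Q \<Longrightarrow> cmod (cinner (T (e n)) (e p)) \<le> r"
    using compact_operator_entries_small[OF onb T \<open>r > 0\<close>]
    unfolding eventually_sequentially by blast
  have "cmod (block_entry e k T m' n i j) \<le> r" if "m' \<ge> Q" for m' n i j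
    unfolding block_entry_def block_vec_def using le_block_start[of k m'] k that
    by (intro Q) auto
  then show ?thesis
    unfolding eventually_sequentially by (meson order_trans)
qed

section \<open>The commutator of two operators of the EAM form\<close>

lemma compact_operator_add:
  assumes "compact_operator T"
  shows "T (u + v) = T u + T v"
  using assms by (simp add: compact_operator_def Vector_Spaces.linear_iff)

lemma compact_operator_scaleC:
  assumes "compact_operator T"
  shows "T (c *\<^sub>C u) = c *\<^sub>C T u"
  using assms by (simp add: compact_operator_def Vector_Spaces.linear_iff)

text \<open>Join two basis vectors by an edge if \<open>C\<close> or \<open>Z\<close> may move one to the other. Each edge is
  used by \<open>C\<close> in one direction and by \<open>Z\<close> in the other, so the diagonal entries of \<open>C Z\<close> and \<open>Z C\<close>
  are sums over closed walks of length two: one product for each edge at \<open>v\<close>. In column \<open>0\<close> the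
  edge from the column to the left is missing. The bound \<open>j < k m\<close> ensures that the edge from
  \<open>(m, j)\<close> exists.\<close>

lemma EAM_commutator_diagonal_entry:
  fixes e :: "nat \<Rightarrow> 'a::complex_hilbert"
  assumes onb: "orthonormal_basis e" and k: "\<And>n. k n > 0" and inc: "\<And>n. k n < k (Suc n)"
    and C: "compact_operator C" and Z: "compact_operator Z"
    and entC: "\<And>m n i j. i < k m \<Longrightarrow> j < k n \<Longrightarrow> block_entry e k C m n i j =
          (if n = m + 1 \<and> j = i then a i m
           else if m = n + 1 \<and> i = j + 1 then - b j n else 0)"
    and entZ: "\<And>m n i j. i < k m \<Longrightarrow> j < k n \<Longrightarrow> block_entry e k Z m n i j =
          (if n = m + 1 \<and> j = i + 1 then x i m
           else if m = n + 1 \<and> i = j then y j n else 0)"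
    and j: "j < k m"
  defines "v \<equiv> block_vec e k (Suc m) j"
  shows "cinner (C (Z v) - Z (C v)) v =
           (a j (Suc m) * y j (Suc m) + b j (Suc m) * x j (Suc m)) -
           (a j m * y j m + (if j = 0 then 0 else b (j - 1) m * x (j - 1) m))"
proof -
  have j': "j < k (Suc m)" "Suc j < k (Suc (Suc m))" "j < k (Suc (Suc m))" "j - 1 < k m"
    using j inc[of m] inc[of "Suc m"] by simp_all
  note entC' = entC[unfolded block_entry_def] and entZ' = entZ[unfolded block_entry_def]
  note simps = cinner_add_left cinner_scaleC_left cinner_zero_left cinner_diff_left
    compact_operator_add[OF C] compact_operator_add[OF Z]
    compact_operator_scaleC[OF C] compact_operator_scaleC[OF Z]
  have Zv: "Z v = (if j = 0 then 0 else x (j - 1) m) *\<^sub>C block_vec e k m (j - 1)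
                + y j (Suc m) *\<^sub>C block_vec e k (Suc (Suc m)) j"
    unfolding v_def
  proof (rule block_vec_eqI[OF onb k])
    fix n i assume i: "i < k n"
    show "cinner (Z (block_vec e k (Suc m) j)) (block_vec e k n i) =
      cinner ((if j = 0 then 0 else x (j - 1) m) *\<^sub>C block_vec e k m (j - 1)
                + y j (Suc m) *\<^sub>C block_vec e k (Suc (Suc m)) j) (block_vec e k n i)"
      using j' i by (auto simp: simps entZ' cinner_block_vec[OF onb])
  qed
  have Cv: "C v = a j m *\<^sub>C block_vec e k m j
                + (- b j (Suc m)) *\<^sub>C block_vec e k (Suc (Suc m)) (Suc j)"
    unfolding v_def
  proof (rule block_vec_eqI[OF onb k])
    fix n i assume i: "i < k n"
    show "cinner (C (block_vec e k (Suc m) j)) (block_vec e k n i) =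
      cinner (a j m *\<^sub>C block_vec e k m j
                + (- b j (Suc m)) *\<^sub>C block_vec e k (Suc (Suc m)) (Suc j)) (block_vec e k n i)"
      using j j' i by (auto simp: simps entC' cinner_block_vec[OF onb] simp del: complex_vector.scale_minus_left)
  qed
  show ?thesis
    unfolding Zv Cv using j j'
    by (auto simp: simps v_def entC' entZ' simp del: complex_vector.scale_minus_left)
qed

section \<open>The mass in the leading columns\<close>

text \<open>What columns \<open>0, \<dots>, J\<close> pass on to each other is all that they send, except for the amount
  that moves from column \<open>J\<close> to column \<open>J + 1\<close>.\<close>

lemma sum_flow_balance:
  fixes s t :: "nat \<Rightarrow> 'a::ab_group_add"
  shows "(\<Sum>i<Suc J. s i + (if i = 0 then 0 else t (i - 1))) = (\<Sum>i<Suc J. s i + t i) - t J"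
  by (induction J) (simp_all add: algebra_simps)

text \<open>Between blocks \<open>M\<close> and \<open>2 M\<close> the first \<open>J\<close> columns receive at least \<open>J / 3\<close>. What they
  hold is at most \<open>J / 8\<close> in modulus, both at the start and at the end, and at most
  \<open>M / 16 \<le> J / 16\<close> leaves through the edges from column \<open>J - 1\<close> to column \<open>J\<close>. But
  \<open>1 / 8 + 1 / 8 + 1 / 16 = 5 / 16 < 1 / 3\<close>.\<close>

lemma slow_flow_contradiction:
  fixes s t :: "nat \<Rightarrow> nat \<Rightarrow> complex"
  assumes M: "M > 0" "M \<le> J"
    and small: "\<And>n i. n \<ge> M \<Longrightarrow> i < J \<Longrightarrow> cmod (s n i) \<le> 1/16 \<and> cmod (t n i) \<le> 1/16"
    and balance: "\<And>n i. n \<ge> M \<Longrightarrow> i < J \<Longrightarrow>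
      (s (Suc n) i + t (Suc n) i) - (s n i + (if i = 0 then 0 else t n (i - 1)))
        = of_real (inverse (real (Suc (Suc n))))"
  shows False
proof -
  define U where "U n = (\<Sum>i<J. s n i + t n i)" for n
  obtain I where I: "J = Suc I"
    using M by (cases J) auto
  have step: "U (Suc n) - U n + t n I = of_real (real J * inverse (real (Suc (Suc n))))"
    if "n \<ge> M" for n
  proof -
    have "U (Suc n) - (U n - t n I) =
        (\<Sum>i<J. (s (Suc n) i + t (Suc n) i) - (s n i + (if i = 0 then 0 else t n (i - 1))))"
      unfolding U_def I sum_flow_balance[symmetric] by (simp add: sum_subtractf)
    also have "\<dots> = (\<Sum>i<J. of_real (inverse (real (Suc (Suc n)))))"
      using that by (intro sum.cong refl balance) auto
    finally show ?thesis by (simp add: algebra_simps)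
  qed
  have U_small: "cmod (U n) \<le> real J / 8" if "n \<ge> M" for n
  proof -
    have "cmod (U n) \<le> (\<Sum>i<J. 1/8)"
      unfolding U_def
    proof (rule sum_norm_le)
      fix i assume "i \<in> {..<J}"
      then show "cmod (s n i + t n i) \<le> 1/8"
        using small[of n i] that norm_triangle_ineq[of "s n i" "t n i"] by simp
    qed
    then show ?thesis by simp
  qed
  have "real J * (M * inverse (3 * real M)) \<le>
      real J * (\<Sum>n\<in>{M..<2*M}. inverse (real (Suc (Suc n))))"
  proof (intro mult_left_mono)
    have "(\<Sum>n\<in>{M..<2*M}. inverse (3 * real M)) \<le> (\<Sum>n\<in>{M..<2*M}. inverse (real (Suc (Suc n))))"
      using M by (intro sum_mono le_imp_inverse_le) auto
    then show "M * inverse (3 * real M) \<le> (\<Sum>n\<in>{M..<2*M}. inverse (real (Suc (Suc n))))"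
      by simp
  qed simp
  then have "real J / 3 \<le> real J * (\<Sum>n\<in>{M..<2*M}. inverse (real (Suc (Suc n))))"
    using M by (simp add: field_simps)
  also have "\<dots> \<le> cmod (of_real (real J * (\<Sum>n\<in>{M..<2*M}. inverse (real (Suc (Suc n))))))"
    by (metis abs_ge_self norm_of_real)
  also have "\<dots> = cmod (\<Sum>n\<in>{M..<2*M}. (U (Suc n) - U n) + t n I)"
    using step by (auto simp: sum_distrib_left intro!: arg_cong[of _ _ cmod] sum.cong)
  also have "\<dots> = cmod ((U (2*M) - U M) + (\<Sum>n\<in>{M..<2*M}. t n I))"
    by (simp add: sum.distrib sum_Suc_diff')
  also have "\<dots> \<le> cmod (U (2*M)) + cmod (U M) + cmod (\<Sum>n\<in>{M..<2*M}. t n I)"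
    by (meson add_right_mono norm_triangle_ineq norm_triangle_ineq4 order_trans)
  also have "cmod (\<Sum>n\<in>{M..<2*M}. t n I) \<le> (\<Sum>n\<in>{M..<2*M}. 1/16)"
    using small I by (intro sum_norm_le) auto
  also have "\<dots> \<le> real J / 16"
    using M by simp
  finally have "real J / 3 \<le> cmod (U (2*M)) + cmod (U M) + real J / 16"
    by simp
  then have "real J / 3 \<le> 5 * real J / 16"
    using U_small[of M] U_small[of "2*M"] by simp
  then show False
    using M by simp
qed

lemma EAM_commutator_neq_diag:
  fixes e :: "nat \<Rightarrow> 'a::complex_hilbert"
  assumes onb: "orthonormal_basis e" and k: "\<And>n. k n > 0" and inc: "\<And>n. k n < k (Suc n)"
    and C: "compact_operator C" and Z: "compact_operator Z" and EAM: "EAM_form e k C Z"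
  shows "diag e (\<lambda>p. of_real (inverse (real (Suc (block_number k p))))) \<noteq> (\<lambda>u. C (Z u) - Z (C u))"
proof
  assume eq: "diag e (\<lambda>p. of_real (inverse (real (Suc (block_number k p))))) = (\<lambda>u. C (Z u) - Z (C u))"
  obtain a b x y where "\<forall>m n i j. i < k m \<longrightarrow> j < k n \<longrightarrow>
        block_entry e k C m n i j =
          (if n = m + 1 \<and> j = i then a i m
           else if m = n + 1 \<and> i = j + 1 then - b j n else 0) \<and>
        block_entry e k Z m n i j =
          (if n = m + 1 \<and> j = i + 1 then x i m
           else if m = n + 1 \<and> i = j then y j n else 0)"
    using EAM unfolding EAM_form_def by blast
  then have
    entC: "\<And>m n i j. i < k m \<Longrightarrow> j < k n \<Longrightarrow> block_entry e k C m n i j =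
          (if n = m + 1 \<and> j = i then a i m
           else if m = n + 1 \<and> i = j + 1 then - b j n else 0)"
    and entZ: "\<And>m n i j. i < k m \<Longrightarrow> j < k n \<Longrightarrow> block_entry e k Z m n i j =
          (if n = m + 1 \<and> j = i + 1 then x i m
           else if m = n + 1 \<and> i = j then y j n else 0)"
    by blast+
  have "\<forall>\<^sub>F M in sequentially. M > 0 \<and>
      (\<forall>m\<ge>M. \<forall>n i j. cmod (block_entry e k C m n i j) \<le> 1/4) \<and>
      (\<forall>m\<ge>M. \<forall>n i j. cmod (block_entry e k Z m n i j) \<le> 1/4)"
    using compact_operator_block_entries_small[OF onb k C, of "1/4"]
      compact_operator_block_entries_small[OF onb k Z, of "1/4"]
    by (intro eventually_conj eventually_gt_at_top) auto
  from eventually_happens'[OF sequentially_bot this] obtain M where M: "M > 0"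
    and smallC: "\<And>m n i j. m \<ge> M \<Longrightarrow> cmod (block_entry e k C m n i j) \<le> 1/4"
    and smallZ: "\<And>m n i j. m \<ge> M \<Longrightarrow> cmod (block_entry e k Z m n i j) \<le> 1/4"
    by auto
  have mono: "strict_mono k"
    using inc by (simp add: strict_mono_Suc_iff)
  show False
  proof (rule slow_flow_contradiction[of M "k M" "\<lambda>n i. a i n * y i n" "\<lambda>n i. b i n * x i n"])
    show "M \<le> k M"
      using mono by (rule strict_mono_imp_increasing)
  next
    fix n i assume n: "n \<ge> M" and "i < k M"
    then have "k M \<le> k n"
      using mono by (simp add: strict_mono_less_eq)
    with \<open>i < k M\<close> have i: "i < k n" "i < k (Suc n)" "Suc i < k (Suc n)"
      using inc[of n] by simp_all
    have bounds: "cmod (a i n) \<le> 1/4" "cmod (b i n) \<le> 1/4" "cmod (x i n) \<le> 1/4" "cmod (y i n) \<le> 1/4"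
      using smallC[of n "Suc n" i i] smallC[of "Suc n" n "Suc i" i]
        smallZ[of n "Suc n" i "Suc i"] smallZ[of "Suc n" n i i] n i
      by (simp_all add: entC entZ)
    show "cmod (a i n * y i n) \<le> 1/16 \<and> cmod (b i n * x i n) \<le> 1/16"
      using mult_mono[OF bounds(1,4)] mult_mono[OF bounds(2,3)] by (simp add: norm_mult)
    have "(a i (Suc n) * y i (Suc n) + b i (Suc n) * x i (Suc n)) -
           (a i n * y i n + (if i = 0 then 0 else b (i - 1) n * x (i - 1) n))
        = cinner (C (Z (block_vec e k (Suc n) i)) - Z (C (block_vec e k (Suc n) i)))
            (block_vec e k (Suc n) i)"
      using EAM_commutator_diagonal_entry[OF onb k inc C Z entC entZ \<open>i < k n\<close>] by simp
    also have "\<dots> = cinner (diag e (\<lambda>p. of_real (inverse (real (Suc (block_number k p)))))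
        (block_vec e k (Suc n) i)) (block_vec e k (Suc n) i)"
      by (simp only: eq)
    also have "\<dots> = of_real (inverse (real (Suc (Suc n))))"
      using block_number_eq[of i k "Suc n"] i
      by (simp add: block_vec_def diag_basis[OF onb] cinner_scaleC_left cinner_basis[OF onb]
            del: of_nat_Suc sum.lessThan_Suc)
    finally show "(a i (Suc n) * y i (Suc n) + b i (Suc n) * x i (Suc n)) -
           (a i n * y i n + (if i = 0 then 0 else b (i - 1) n * x (i - 1) n))
        = of_real (inverse (real (Suc (Suc n))))" .
  qed (fact M)
qed

theorem corollary3p12:
  fixes e :: "nat \<Rightarrow> 'a::complex_hilbert" and k :: "nat \<Rightarrow> nat" and q :: real
  assumes "orthonormal_basis e"
    and "\<And>n. k n > 0"
    and "q > 1"
    and "\<And>n. real (k (Suc n)) \<ge> q * real (k n)"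
  shows "\<exists>d :: nat \<Rightarrow> real. (\<forall>n. d n > 0) \<and> d \<longlonglongrightarrow> 0 \<and>
    (\<forall>C Z. compact_operator C \<and> compact_operator Z \<and> EAM_form e k C Z \<longrightarrow>
       diag e (\<lambda>n. complex_of_real (d n)) \<noteq> (\<lambda>u. C (Z u) - Z (C u)))"
proof (intro exI[of _ "\<lambda>p. inverse (real (Suc (block_number k p)))"] conjI allI impI)
  show "(\<lambda>p. inverse (real (Suc (block_number k p)))) \<longlonglongrightarrow> 0"
    using filterlim_compose[OF LIMSEQ_inverse_real_of_nat block_number_at_top[OF assms(2)]] .
next
  fix C Z assume "compact_operator C \<and> compact_operator Z \<and> EAM_form e k C Z"
  moreover have "k n < k (Suc n)" for n
  proof -
    have "real (k n) < q * real (k n)"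
      using assms(2)[of n] \<open>q > 1\<close> by simp
    with assms(4)[of n] show ?thesis by linarith
  qed
  ultimately show "diag e (\<lambda>p. complex_of_real (inverse (real (Suc (block_number k p)))))
      \<noteq> (\<lambda>u. C (Z u) - Z (C u))"
    using EAM_commutator_neq_diag[of e k C Z] assms(1,2) by blast
qed simp

end
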